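(* Let $\Omega\subset\mathbb R^N$ be a bounded Lipschitz domain, $s\in(0,1)$, $\alpha>0$, $y^\delta\in L^2(\Omega)$, and let $K:H_0^s(\Omega)\to L^2(\Omega)$ be bounded and linear. Let $u_\alpha^\delta\in H_0^s(\Omega)$ be the unique minimizer over $H_0^s(\Omega)$ of $$J_\alpha(u)=\frac12\|Ku-y^\delta\|_{L^2(\Omega)}^2+\frac{\alpha}{2}\|u\|_{H_0^s(\Omega)}^2.$$ Then $u=u_\alpha^\delta$ satisfies $$(Ku-y^\delta,Kv)_{L^2(\Omega)}+\alpha\,(u,v)_{H_0^s(\Omega)}=0\qquad\text{for all }v\in H_0^s(\Omega).\quad( * )$$ Equivalently, $u_\alpha^\delta$ is the unique weak solution (i.e. the unique $u\in H_0^s(\Omega)$ satisfying $( * )$) of $$K^*(Ku_\alpha^\delta-y^\delta)+\alpha\left(I+(-\Delta)^s\right)u_\alpha^\delta=0\quad\text{in }H^{-s}(\Omega),$$ or, equivalently, of $$\left(K^*K+\alpha\left(I+(-\Delta)^s\right)\right)u_\alpha^\delta=K^*y^\delta .$$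
   Context: All spaces are real. $H_0^s(\Omega)$ is the space of functions $u\in H^s(\mathbb R^N)$ with $u=0$ a.e. in $\mathbb R^N\setminus\Omega$ (also regarded as functions on $\Omega$). It is a Hilbert space with inner product $$(u,v)_{H_0^s(\Omega)}=\int_\Omega uv\,dx+\frac{C_{N,s}}{2}\iint_{\mathbb R^{2N}}\frac{(u(x)-u(y))(v(x)-v(y))}{|x-y|^{N+2s}}\,dx\,dy$$ and norm $\|u\|_{H_0^s(\Omega)}^2=(u,u)_{H_0^s(\Omega)}$, where $C_{N,s}>0$ is the standard normalization constant of the integral fractional Laplacian, $C_{N,s}=\frac{4^s s\,\Gamma(N/2+s)}{\pi^{N/2}\Gamma(1-s)}$. $H^{-s}(\Omega)$ is the dual of $H_0^s(\Omega)$. The operator $I+(-\Delta)^s:H_0^s(\Omega)\to H^{-s}(\Omega)$ (integral fractional Laplacian with homogeneous exterior Dirichlet condition) is defined by $\langle (I+(-\Delta)^s)u,v\rangle_{H^{-s},H_0^s}=(u,v)_{H_0^s(\Omega)}$. $K^*:L^2(\Omega)\to H^{-s}(\Omega)$ is the adjoint, $\langle K^*g,v\rangle_{H^{-s},H_0^s}=(g,Kv)_{L^2(\Omega)}$. *)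

theory Defs
  imports "HOL-Analysis.Analysis"
begin

text \<open>
  Elements of the function spaces are represented by functions, and two functions denote the same
  element iff they agree almost everywhere. The representatives are Borel measurable, which loses
  nothing because every Lebesgue measurable function agrees a.e. with a Borel one. Vector space
  operations on functions and on functionals are pointwise.
\<close>

text \<open>
  Near each boundary point, the set is the part of a ball lying strictly above the graph of a
  Lipschitz function. Here \<open>\<nu>\<close> is the vertical direction of the local coordinate system and the
  hyperplane orthogonal to \<open>\<nu>\<close> carries the remaining coordinates.
\<close>
definition bounded_lipschitz_domain :: "(real ^ 'n) set \<Rightarrow> bool" where
  "bounded_lipschitz_domain \<Omega> \<longleftrightarrow>
     \<Omega> \<noteq> {} \<and> open \<Omega> \<and> connected \<Omega> \<and> bounded \<Omega> \<and>
     (\<forall>p \<in> frontier \<Omega>. \<exists>r > 0. \<exists>\<nu> L. \<exists>\<phi> :: real ^ 'n \<Rightarrow> real.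
        norm \<nu> = 1 \<and> lipschitz_on L {z. z \<bullet> \<nu> = 0} \<phi> \<and>
        \<Omega> \<inter> ball p r = {x \<in> ball p r. x \<bullet> \<nu> > \<phi> (x - (x \<bullet> \<nu>) *\<^sub>R \<nu>)})"

definition L2 :: "(real ^ 'n) set \<Rightarrow> (real ^ 'n \<Rightarrow> real) set" where
  "L2 \<Omega> = {f. set_borel_measurable lborel \<Omega> f \<and> set_integrable lborel \<Omega> (\<lambda>x. (f x)\<^sup>2)}"

definition L2_inner :: "(real ^ 'n) set \<Rightarrow> (real ^ 'n \<Rightarrow> real) \<Rightarrow> (real ^ 'n \<Rightarrow> real) \<Rightarrow> real" where
  "L2_inner \<Omega> f g = (LINT x:\<Omega>|lborel. f x * g x)"

definition L2_norm :: "(real ^ 'n) set \<Rightarrow> (real ^ 'n \<Rightarrow> real) \<Rightarrow> real" where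
  "L2_norm \<Omega> f = sqrt (L2_inner \<Omega> f f)"

text \<open>On the diagonal the integrands below are \<open>0 / 0 = 0\<close>; the diagonal is a null set.\<close>
definition Hs :: "real \<Rightarrow> (real ^ 'n \<Rightarrow> real) set" where
  "Hs s = {u. u \<in> borel_measurable lborel \<and> integrable lborel (\<lambda>x. (u x)\<^sup>2) \<and>
     integrable (lborel \<Otimes>\<^sub>M lborel)
       (\<lambda>(x, y). (u x - u y)\<^sup>2 / norm (x - y) powr (real CARD('n) + 2 * s))}"

definition H0s :: "(real ^ 'n) set \<Rightarrow> real \<Rightarrow> (real ^ 'n \<Rightarrow> real) set" where
  "H0s \<Omega> s = {u \<in> Hs s. AE x in lborel. x \<notin> \<Omega> \<longrightarrow> u x = 0}"

definition frac_lap_const :: "nat \<Rightarrow> real \<Rightarrow> real" where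
  "frac_lap_const N s =
     4 powr s * s * Gamma (real N / 2 + s) / (pi powr (real N / 2) * Gamma (1 - s))"

definition H0s_inner ::
  "(real ^ 'n) set \<Rightarrow> real \<Rightarrow> (real ^ 'n \<Rightarrow> real) \<Rightarrow> (real ^ 'n \<Rightarrow> real) \<Rightarrow> real" where
  "H0s_inner \<Omega> s u v = (LINT x:\<Omega>|lborel. u x * v x) +
     frac_lap_const CARD('n) s / 2 *
       (LINT (x, y)|(lborel \<Otimes>\<^sub>M lborel).
          (u x - u y) * (v x - v y) / norm (x - y) powr (real CARD('n) + 2 * s))"

definition H0s_norm :: "(real ^ 'n) set \<Rightarrow> real \<Rightarrow> (real ^ 'n \<Rightarrow> real) \<Rightarrow> real" where
  "H0s_norm \<Omega> s u = sqrt (H0s_inner \<Omega> s u u)"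

text \<open>
  Linearity holds as an identity in \<open>L2 \<Omega>\<close>, i.e. a.e. in \<open>\<Omega>\<close>. Together with boundedness it forces
  \<open>K\<close> to respect a.e. equality, so that \<open>K\<close> is an operator on equivalence classes.
\<close>
definition bounded_linear_H0s_L2 ::
  "(real ^ 'n) set \<Rightarrow> real \<Rightarrow> ((real ^ 'n \<Rightarrow> real) \<Rightarrow> (real ^ 'n \<Rightarrow> real)) \<Rightarrow> bool" where
  "bounded_linear_H0s_L2 \<Omega> s K \<longleftrightarrow>
     (\<forall>u \<in> H0s \<Omega> s. K u \<in> L2 \<Omega>) \<and>
     (\<forall>u \<in> H0s \<Omega> s. \<forall>v \<in> H0s \<Omega> s.
        AE x in lborel. x \<in> \<Omega> \<longrightarrow> K (\<lambda>z. u z + v z) x = K u x + K v x) \<and>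
     (\<forall>c. \<forall>u \<in> H0s \<Omega> s. AE x in lborel. x \<in> \<Omega> \<longrightarrow> K (\<lambda>z. c * u z) x = c * K u x) \<and>
     (\<exists>B. \<forall>u \<in> H0s \<Omega> s. L2_norm \<Omega> (K u) \<le> B * H0s_norm \<Omega> s u)"

definition Tikhonov ::
  "(real ^ 'n) set \<Rightarrow> real \<Rightarrow> ((real ^ 'n \<Rightarrow> real) \<Rightarrow> (real ^ 'n \<Rightarrow> real)) \<Rightarrow>
   (real ^ 'n \<Rightarrow> real) \<Rightarrow> real \<Rightarrow> (real ^ 'n \<Rightarrow> real) \<Rightarrow> real" where
  "Tikhonov \<Omega> s K y \<alpha> u =
     1 / 2 * (L2_norm \<Omega> (\<lambda>x. K u x - y x))\<^sup>2 + \<alpha> / 2 * (H0s_norm \<Omega> s u)\<^sup>2"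

text \<open>The dual space \<open>H\<^sup>-\<^sup>s\<close>; the values of a functional outside \<open>H0s \<Omega> s\<close> are irrelevant.\<close>
definition dual_H0s :: "(real ^ 'n) set \<Rightarrow> real \<Rightarrow> ((real ^ 'n \<Rightarrow> real) \<Rightarrow> real) set" where
  "dual_H0s \<Omega> s = {F.
     (\<forall>u \<in> H0s \<Omega> s. \<forall>v \<in> H0s \<Omega> s. F (\<lambda>x. u x + v x) = F u + F v) \<and>
     (\<forall>c. \<forall>u \<in> H0s \<Omega> s. F (\<lambda>x. c * u x) = c * F u) \<and>
     (\<exists>B. \<forall>u \<in> H0s \<Omega> s. \<bar>F u\<bar> \<le> B * H0s_norm \<Omega> s u)}"

definition eq_in_dual_H0s ::
  "(real ^ 'n) set \<Rightarrow> real \<Rightarrow> ((real ^ 'n \<Rightarrow> real) \<Rightarrow> real) \<Rightarrow>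
   ((real ^ 'n \<Rightarrow> real) \<Rightarrow> real) \<Rightarrow> bool" where
  "eq_in_dual_H0s \<Omega> s F G \<longleftrightarrow>
     F \<in> dual_H0s \<Omega> s \<and> G \<in> dual_H0s \<Omega> s \<and> (\<forall>v \<in> H0s \<Omega> s. F v = G v)"

definition I_plus_frac_lap ::
  "(real ^ 'n) set \<Rightarrow> real \<Rightarrow> (real ^ 'n \<Rightarrow> real) \<Rightarrow> ((real ^ 'n \<Rightarrow> real) \<Rightarrow> real)" where
  "I_plus_frac_lap \<Omega> s u = (\<lambda>v. H0s_inner \<Omega> s u v)"

definition adjoint_K ::
  "(real ^ 'n) set \<Rightarrow> ((real ^ 'n \<Rightarrow> real) \<Rightarrow> (real ^ 'n \<Rightarrow> real)) \<Rightarrow>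
   (real ^ 'n \<Rightarrow> real) \<Rightarrow> ((real ^ 'n \<Rightarrow> real) \<Rightarrow> real)" where
  "adjoint_K \<Omega> K g = (\<lambda>v. L2_inner \<Omega> g (K v))"

definition unique_in_H0s ::
  "(real ^ 'n) set \<Rightarrow> real \<Rightarrow> ((real ^ 'n \<Rightarrow> real) \<Rightarrow> bool) \<Rightarrow> (real ^ 'n \<Rightarrow> real) \<Rightarrow> bool" where
  "unique_in_H0s \<Omega> s P u \<longleftrightarrow>
     u \<in> H0s \<Omega> s \<and> P u \<and> (\<forall>w \<in> H0s \<Omega> s. P w \<longrightarrow> (AE x in lborel. w x = u x))"

definition minimizes_Tikhonov ::
  "(real ^ 'n) set \<Rightarrow> real \<Rightarrow> ((real ^ 'n \<Rightarrow> real) \<Rightarrow> (real ^ 'n \<Rightarrow> real)) \<Rightarrow>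
   (real ^ 'n \<Rightarrow> real) \<Rightarrow> real \<Rightarrow> (real ^ 'n \<Rightarrow> real) \<Rightarrow> bool" where
  "minimizes_Tikhonov \<Omega> s K y \<alpha> u \<longleftrightarrow>
     (\<forall>w \<in> H0s \<Omega> s. Tikhonov \<Omega> s K y \<alpha> u \<le> Tikhonov \<Omega> s K y \<alpha> w)"

definition weak_solution ::
  "(real ^ 'n) set \<Rightarrow> real \<Rightarrow> ((real ^ 'n \<Rightarrow> real) \<Rightarrow> (real ^ 'n \<Rightarrow> real)) \<Rightarrow>
   (real ^ 'n \<Rightarrow> real) \<Rightarrow> real \<Rightarrow> (real ^ 'n \<Rightarrow> real) \<Rightarrow> bool" where
  "weak_solution \<Omega> s K y \<alpha> u \<longleftrightarrow>
     (\<forall>v \<in> H0s \<Omega> s. L2_inner \<Omega> (\<lambda>x. K u x - y x) (K v) + \<alpha> * H0s_inner \<Omega> s u v = 0)"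

definition residual_equation ::
  "(real ^ 'n) set \<Rightarrow> real \<Rightarrow> ((real ^ 'n \<Rightarrow> real) \<Rightarrow> (real ^ 'n \<Rightarrow> real)) \<Rightarrow>
   (real ^ 'n \<Rightarrow> real) \<Rightarrow> real \<Rightarrow> (real ^ 'n \<Rightarrow> real) \<Rightarrow> bool" where
  "residual_equation \<Omega> s K y \<alpha> u \<longleftrightarrow>
     eq_in_dual_H0s \<Omega> s
       (\<lambda>v. adjoint_K \<Omega> K (\<lambda>x. K u x - y x) v + \<alpha> * I_plus_frac_lap \<Omega> s u v) (\<lambda>v. 0)"

definition normal_equation ::
  "(real ^ 'n) set \<Rightarrow> real \<Rightarrow> ((real ^ 'n \<Rightarrow> real) \<Rightarrow> (real ^ 'n \<Rightarrow> real)) \<Rightarrow>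
   (real ^ 'n \<Rightarrow> real) \<Rightarrow> real \<Rightarrow> (real ^ 'n \<Rightarrow> real) \<Rightarrow> bool" where
  "normal_equation \<Omega> s K y \<alpha> u \<longleftrightarrow>
     eq_in_dual_H0s \<Omega> s
       (\<lambda>v. adjoint_K \<Omega> K (K u) v + \<alpha> * I_plus_frac_lap \<Omega> s u v) (adjoint_K \<Omega> K y)"

end

theory Submission
  imports Defs
begin

text \<open>
  On \<open>H\<^sub>0\<^sup>s\<close> put the inner product \<open>a(u, v) = (Ku, Kv) + \<alpha> (u, v)\<close>, whose norm is equivalent to
  that of \<open>H\<^sub>0\<^sup>s\<close>, and the functional \<open>l v = (y, Kv)\<close>. Up to a constant the Tikhonov functional is
  \<open>a(u, u) / 2 - l u\<close>, and its minimizers are exactly the solutions of \<open>a(u, \<cdot>) = l\<close>.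
  By the parallelogram identity a minimizing sequence \<open>u\<^sub>n\<close> is Cauchy, and comparing the energy of
  \<open>u\<^sub>n\<close> with that of \<open>u\<^sub>n + t v\<close> for all real \<open>t\<close> shows \<open>a(u\<^sub>n, v) \<longlonglongrightarrow> l v\<close>, so its limit
  solves the equation. Completeness of \<open>H\<^sub>0\<^sup>s\<close> is the Riesz--Fischer argument: a fast Cauchy
  sequence converges almost everywhere, and Fatou's lemma, applied to the functions and to their
  difference quotients, turns this into convergence in norm.
\<close>

section \<open>Variational theory of positive semidefinite forms\<close>

text \<open>The vertex of the parabola is tested, or, if \<open>r = 0\<close>, a point where the
  line is negative. With \<open>p = a u u\<close> this is Cauchy-Schwarz, with \<open>p = 0\<close>
  it forces the first variation to vanish at a minimizer, and with small \<open>p\<close> it bounds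
  the first variation at a near-minimizer.\<close>

lemma quadratic_nonneg_imp_discriminant:
  fixes p q r :: real
  assumes "\<And>t. 0 \<le> p + t * q + t\<^sup>2 * r" and "0 \<le> r"
  shows "q\<^sup>2 \<le> 4 * p * r"
proof (cases "r = 0")
  case True
  have "q = 0"
  proof (rule ccontr)
    assume "q \<noteq> 0"
    then show False
      using assms(1)[of "- (p + 1) / q"] True by simp
  qed
  then show ?thesis using True by simp
next
  case False
  then have r: "r > 0" using assms(2) by simp
  have "0 \<le> p + (- q / (2 * r)) * q + (- q / (2 * r))\<^sup>2 * r"
    by (rule assms(1))
  also have "\<dots> = (4 * p * r - q\<^sup>2) / (4 * r)"
    using r by (simp add: field_simps power2_eq_square)
  finally show ?thesis
    using r by (simp add: zero_le_divide_iff)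
qed

lemma tendsto_zero_if_square_tendsto_zero:
  fixes f :: "'a \<Rightarrow> real"
  assumes "((\<lambda>x. (f x)\<^sup>2) \<longlongrightarrow> 0) F"
  shows "(f \<longlongrightarrow> 0) F"
  using tendsto_real_sqrt[OF assms] by (simp add: tendsto_rabs_zero_iff)

text \<open>Elements are representatives, so the form is only semidefinite: a nonzero function may
  have \<open>a u u = 0\<close>. Working with a set of functions under pointwise operations avoids
  passing to a quotient space.\<close>

locale semi_inner_product =
  fixes V :: "('a \<Rightarrow> real) set" and a :: "('a \<Rightarrow> real) \<Rightarrow> ('a \<Rightarrow> real) \<Rightarrow> real"
  assumes zero_mem: "(\<lambda>x. 0) \<in> V"
    and add_mem: "u \<in> V \<Longrightarrow> v \<in> V \<Longrightarrow> (\<lambda>x. u x + v x) \<in> V"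
    and scale_mem: "u \<in> V \<Longrightarrow> (\<lambda>x. c * u x) \<in> V"
    and add_left: "u \<in> V \<Longrightarrow> v \<in> V \<Longrightarrow> w \<in> V \<Longrightarrow> a (\<lambda>x. u x + v x) w = a u w + a v w"
    and scale_left: "u \<in> V \<Longrightarrow> w \<in> V \<Longrightarrow> a (\<lambda>x. c * u x) w = c * a u w"
    and sym: "u \<in> V \<Longrightarrow> v \<in> V \<Longrightarrow> a u v = a v u"
    and nonneg: "u \<in> V \<Longrightarrow> 0 \<le> a u u"
begin

lemma diff_mem: "u \<in> V \<Longrightarrow> v \<in> V \<Longrightarrow> (\<lambda>x. u x - v x) \<in> V"
  using add_mem[of u "\<lambda>x. (-1) * v x"] scale_mem[of v "-1"] by simp

lemma diff_left:
  "u \<in> V \<Longrightarrow> v \<in> V \<Longrightarrow> w \<in> V \<Longrightarrow> a (\<lambda>x. u x - v x) w = a u w - a v w"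
  using add_left[of u "\<lambda>x. (-1) * v x" w] scale_mem[of v "-1"] scale_left[of v w "-1"] by simp

lemma add_right:
  "u \<in> V \<Longrightarrow> v \<in> V \<Longrightarrow> w \<in> V \<Longrightarrow> a w (\<lambda>x. u x + v x) = a w u + a w v"
  using add_left[of u v w] by (simp add: sym[of w] add_mem)

lemma scale_right: "u \<in> V \<Longrightarrow> w \<in> V \<Longrightarrow> a w (\<lambda>x. c * u x) = c * a w u"
  using scale_left[of u w c] by (simp add: sym[of w] scale_mem)

lemma diff_right:
  "u \<in> V \<Longrightarrow> v \<in> V \<Longrightarrow> w \<in> V \<Longrightarrow> a w (\<lambda>x. u x - v x) = a w u - a w v"
  using diff_left[of u v w] by (simp add: sym[of w] diff_mem)

lemma form_shift:
  assumes "u \<in> V" "v \<in> V"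
  shows "a (\<lambda>x. u x + t * v x) (\<lambda>x. u x + t * v x) = a u u + 2 * t * a u v + t\<^sup>2 * a v v"
  using assms sym[of u v]
  by (simp add: add_left add_right scale_left scale_right add_mem scale_mem power2_eq_square
      algebra_simps)

lemma Cauchy_Schwarz:
  assumes "u \<in> V" "v \<in> V"
  shows "(a u v)\<^sup>2 \<le> a u u * a v v"
proof -
  have "(2 * a u v)\<^sup>2 \<le> 4 * a u u * a v v"
  proof (rule quadratic_nonneg_imp_discriminant)
    fix t
    show "0 \<le> a u u + t * (2 * a u v) + t\<^sup>2 * a v v"
      using form_shift[OF assms, of t] nonneg[OF add_mem[OF assms(1) scale_mem[OF assms(2), of t]]]
      by (simp add: algebra_simps)
  qed (rule nonneg[OF assms(2)])
  then show ?thesis by simp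
qed

lemma abs_le_sqrt:
  assumes "u \<in> V" "v \<in> V"
  shows "\<bar>a u v\<bar> \<le> sqrt (a u u) * sqrt (a v v)"
  using real_sqrt_le_mono[OF Cauchy_Schwarz[OF assms]] by (simp only: real_sqrt_abs real_sqrt_mult)

text \<open>The linear coefficient is the residual of the Euler-Lagrange equation tested with
  \<open>v\<close>, which is how minimality and the equation are linked.\<close>

lemma energy_shift:
  fixes l :: "('a \<Rightarrow> real) \<Rightarrow> real"
  assumes "u \<in> V" "v \<in> V"
    and "\<forall>u \<in> V. \<forall>v \<in> V. \<forall>t. l (\<lambda>x. u x + t * v x) = l u + t * l v"
  shows "a (\<lambda>x. u x + t * v x) (\<lambda>x. u x + t * v x) / 2 - l (\<lambda>x. u x + t * v x) =
    (a u u / 2 - l u) + t * (a u v - l v) + t\<^sup>2 * (a v v / 2)"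
  using assms by (simp add: form_shift algebra_simps)

lemma minimizer_iff_Euler_Lagrange:
  fixes l :: "('a \<Rightarrow> real) \<Rightarrow> real"
  assumes u: "u \<in> V"
    and linear: "\<forall>u \<in> V. \<forall>v \<in> V. \<forall>t. l (\<lambda>x. u x + t * v x) = l u + t * l v"
  shows "(\<forall>w \<in> V. a u u / 2 - l u \<le> a w w / 2 - l w) \<longleftrightarrow> (\<forall>v \<in> V. a u v = l v)"
proof
  assume min: "\<forall>w \<in> V. a u u / 2 - l u \<le> a w w / 2 - l w"
  show "\<forall>v \<in> V. a u v = l v"
  proof
    fix v assume v: "v \<in> V"
    \<comment> \<open>Minimality along the line through \<open>u\<close> in direction
      \<open>v\<close> makes the increment of the energy nonnegative for every \<open>t\<close>; its
      constant term 0 kills the linear coefficient.\<close>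
    have "(a u v - l v)\<^sup>2 \<le> 4 * 0 * (a v v / 2)"
    proof (rule quadratic_nonneg_imp_discriminant)
      fix t
      show "0 \<le> 0 + t * (a u v - l v) + t\<^sup>2 * (a v v / 2)"
        using energy_shift[OF u v linear, of t]
          min[rule_format, OF add_mem[OF u scale_mem[OF v, of t]]] by linarith
    qed (use nonneg[OF v] in simp)
    then show "a u v = l v" by simp
  qed
next
  assume eq: "\<forall>v \<in> V. a u v = l v"
  show "\<forall>w \<in> V. a u u / 2 - l u \<le> a w w / 2 - l w"
  proof
    fix w assume w: "w \<in> V"
    have d: "(\<lambda>x. w x - u x) \<in> V" by (rule diff_mem[OF w u])
    have w_eq: "(\<lambda>x. u x + 1 * (w x - u x)) = w" by simp
    \<comment> \<open>The linear term drops out by the equation tested with \<open>w - u\<close>, so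
      the surplus energy is half a square.\<close>
    have "a w w / 2 - l w = (a u u / 2 - l u) + a (\<lambda>x. w x - u x) (\<lambda>x. w x - u x) / 2"
      using energy_shift[OF u d linear, of 1] bspec[OF eq d]
      by (simp only: w_eq power_one) simp
    then show "a u u / 2 - l u \<le> a w w / 2 - l w"
      using nonneg[OF d] by linarith
  qed
qed

text \<open>
  Completeness is only required along sequences of geometric rate, which is what a minimizing
  sequence of the energy provides by the parallelogram identity.
\<close>
lemma Euler_Lagrange_solvable:
  fixes l :: "('a \<Rightarrow> real) \<Rightarrow> real"
  assumes linear: "\<forall>u \<in> V. \<forall>v \<in> V. \<forall>t. l (\<lambda>x. u x + t * v x) = l u + t * l v"
    and bounded: "\<And>u. u \<in> V \<Longrightarrow> \<bar>l u\<bar> \<le> B * sqrt (a u u)"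
    and complete: "\<And>U C. (\<And>n::nat. U n \<in> V) \<Longrightarrow>
      (\<And>m n. n \<le> m \<Longrightarrow> a (\<lambda>x. U m x - U n x) (\<lambda>x. U m x - U n x) \<le> C * (1/4) ^ n) \<Longrightarrow>
      \<exists>u \<in> V. (\<lambda>n. a (\<lambda>x. u x - U n x) (\<lambda>x. u x - U n x)) \<longlonglongrightarrow> 0"
  shows "\<exists>u \<in> V. \<forall>v \<in> V. a u v = l v"
proof -
  define J where "J u = a u u / 2 - l u" for u
  have J_bound: "- (B\<^sup>2 / 2) \<le> J u" if "u \<in> V" for u
  proof -
    have "0 \<le> (sqrt (a u u) - B)\<^sup>2 / 2" by simp
    also have "\<dots> = a u u / 2 - B * sqrt (a u u) + B\<^sup>2 / 2"
      using nonneg[OF that] by (simp add: power2_diff field_simps)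
    finally show ?thesis using bounded[OF that] unfolding J_def by linarith
  qed
  define m where "m = Inf (J ` V)"
  have bdd: "bdd_below (J ` V)"
    using J_bound by (intro bdd_belowI[of _ "- (B\<^sup>2 / 2)"]) auto
  have m_le: "m \<le> J u" if "u \<in> V" for u
    unfolding m_def using bdd that by (intro cInf_lower) auto
  \<comment> \<open>The tolerance \<open>(1/4) ^ n\<close> is chosen to match the rate in
    \<open>complete\<close>.\<close>
  have "\<exists>u \<in> V. J u < m + (1/4) ^ n" for n :: nat
  proof -
    have "J ` V \<noteq> {}" using zero_mem by auto
    then show ?thesis
      using cInf_lessD[of "J ` V" "m + (1/4) ^ n"] unfolding m_def by auto
  qed
  then obtain U where U: "U n \<in> V" "J (U n) < m + (1/4) ^ n" for n :: nat
    by metis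
  have "a (\<lambda>x. U k x - U n x) (\<lambda>x. U k x - U n x) \<le> 8 * (1/4) ^ n" if "n \<le> k" for k n
  proof -
    let ?d = "\<lambda>x. U k x - U n x"
    have d: "?d \<in> V" by (intro diff_mem U)
    have "J (\<lambda>x. U n x + t * ?d x) = J (U n) + t * (a (U n) ?d - l ?d) + t\<^sup>2 * (a ?d ?d / 2)" for t
      unfolding J_def by (rule energy_shift[OF U(1) d linear])
    \<comment> \<open>\<open>t = 1\<close> gives the energy of \<open>U k\<close> and
      \<open>t = 1/2\<close> that of the midpoint; eliminating the linear coefficient leaves the
      parallelogram identity. The midpoint has energy at least \<open>m\<close> and the two errors
      add up to at most \<open>2 * (1/4) ^ n\<close>, which yields the factor 8.\<close>
    from this[of 1] this[of "1/2"]
    have "a ?d ?d / 4 = J (U k) + J (U n) - 2 * J (\<lambda>x. U n x + 1/2 * ?d x)"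
      by (simp add: power2_eq_square field_simps)
    moreover have "m \<le> J (\<lambda>x. U n x + 1/2 * ?d x)"
      by (intro m_le add_mem scale_mem d U)
    moreover have "(1/4::real) ^ k \<le> (1/4) ^ n"
      using that by (intro power_decreasing) auto
    ultimately show ?thesis using U(2)[of k] U(2)[of n] by linarith
  qed
  from complete[OF U(1) this] obtain u where u: "u \<in> V"
    and lim: "(\<lambda>n. a (\<lambda>x. u x - U n x) (\<lambda>x. u x - U n x)) \<longlonglongrightarrow> 0"
    by blast
  have "a u v = l v" if v: "v \<in> V" for v
  proof -
    have "(\<lambda>n. (a (U n) v - l v)\<^sup>2) \<longlonglongrightarrow> 0"
    proof (rule tendsto_sandwich[OF _ _ tendsto_const])
      show "\<forall>\<^sub>F n in sequentially. 0 \<le> (a (U n) v - l v)\<^sup>2" by simp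
      \<comment> \<open>The energy of \<open>U n + t v\<close> is at least \<open>m\<close>, while
        that of \<open>U n\<close> is within \<open>(1/4) ^ n\<close> of it, so the increment is at
        least \<open>- ((1/4) ^ n)\<close> for all \<open>t\<close>.\<close>
      have "(a (U n) v - l v)\<^sup>2 \<le> 4 * (1/4) ^ n * (a v v / 2)" for n
      proof (rule quadratic_nonneg_imp_discriminant)
        fix t
        have "m \<le> J (\<lambda>x. U n x + t * v x)"
          by (intro m_le add_mem scale_mem v U)
        also have "\<dots> = J (U n) + t * (a (U n) v - l v) + t\<^sup>2 * (a v v / 2)"
          unfolding J_def by (rule energy_shift[OF U(1) v linear])
        finally show "0 \<le> (1/4) ^ n + t * (a (U n) v - l v) + t\<^sup>2 * (a v v / 2)"
          using U(2)[of n] by linarith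
      qed (use nonneg[OF v] in simp)
      then show "\<forall>\<^sub>F n in sequentially. (a (U n) v - l v)\<^sup>2 \<le> 4 * (1/4) ^ n * (a v v / 2)"
        by simp
      show "(\<lambda>n. 4 * (1/4) ^ n * (a v v / 2)) \<longlonglongrightarrow> 0"
        by (intro tendsto_mult_left_zero tendsto_mult_right_zero LIMSEQ_power_zero) simp
    qed
    then have 1: "(\<lambda>n. a (U n) v - l v) \<longlonglongrightarrow> 0"
      by (rule tendsto_zero_if_square_tendsto_zero)
    \<comment> \<open>Cauchy-Schwarz turns convergence in the seminorm into convergence of
      \<open>a (U n) v\<close> to \<open>a u v\<close>.\<close>
    have "(\<lambda>n. (a (\<lambda>x. u x - U n x) v)\<^sup>2) \<longlonglongrightarrow> 0"
    proof (rule tendsto_sandwich[OF _ _ tendsto_const])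
      show "\<forall>\<^sub>F n in sequentially.
          (a (\<lambda>x. u x - U n x) v)\<^sup>2 \<le> a (\<lambda>x. u x - U n x) (\<lambda>x. u x - U n x) * a v v"
        using Cauchy_Schwarz[OF diff_mem[OF u U(1)] v] by simp
      show "(\<lambda>n. a (\<lambda>x. u x - U n x) (\<lambda>x. u x - U n x) * a v v) \<longlonglongrightarrow> 0"
        by (intro tendsto_mult_left_zero lim)
    qed simp
    then have "(\<lambda>n. a u v - a (U n) v) \<longlonglongrightarrow> 0"
      using diff_left[OF u U(1) v] by (auto dest: tendsto_zero_if_square_tendsto_zero)
    from tendsto_add[OF this 1] have "(\<lambda>n::nat. a u v - l v) \<longlonglongrightarrow> 0" by simp
    then show ?thesis by (simp add: LIMSEQ_const_iff)
  qed
  with u show ?thesis by blast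
qed

end

section \<open>Square integrable functions: inner product, Fatou's lemma, almost everywhere
  limits\<close>

text \<open>The measure is arbitrary because the space is needed both on R^N, for functions, and on
  R^N x R^N, for their difference quotients.\<close>

definition square_integrable :: "'a measure \<Rightarrow> ('a \<Rightarrow> real) set" where
  "square_integrable M = {f \<in> borel_measurable M. integrable M (\<lambda>x. (f x)\<^sup>2)}"

lemma integrable_mult_square_integrable:
  assumes "f \<in> square_integrable M" "g \<in> square_integrable M"
  shows "integrable M (\<lambda>x. f x * g x)"
proof (rule Bochner_Integration.integrable_bound)
  show "integrable M (\<lambda>x. (f x)\<^sup>2 + (g x)\<^sup>2)"
    using assms by (auto simp: square_integrable_def)
  show "(\<lambda>x. f x * g x) \<in> borel_measurable M"
    using assms by (auto simp: square_integrable_def)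
  have "\<bar>b * c\<bar> \<le> b\<^sup>2 + c\<^sup>2" for b c :: real
  proof -
    have "0 \<le> \<bar>b\<bar> * \<bar>c\<bar>" by simp
    then have "\<bar>b * c\<bar> \<le> 2 * \<bar>b\<bar> * \<bar>c\<bar>" unfolding abs_mult by linarith
    then show ?thesis using sum_squares_bound[of "\<bar>b\<bar>" "\<bar>c\<bar>"] by simp
  qed
  then show "AE x in M. norm (f x * g x) \<le> norm ((f x)\<^sup>2 + (g x)\<^sup>2)"
    by simp
qed

lemma semi_inner_product_square_integrable:
  "semi_inner_product (square_integrable M) (\<lambda>f g. \<integral>x. f x * g x \<partial>M)"
proof
  fix u v w :: "'a \<Rightarrow> real" and c :: real
  show "(\<lambda>x. 0) \<in> square_integrable M"
    by (simp add: square_integrable_def)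
  assume u: "u \<in> square_integrable M"
  show "(\<lambda>x. c * u x) \<in> square_integrable M"
    using u by (auto simp: square_integrable_def power_mult_distrib)
  show "0 \<le> (\<integral>x. u x * u x \<partial>M)"
    by simp
  { assume v: "v \<in> square_integrable M"
    have "integrable M (\<lambda>x. (u x)\<^sup>2 + (v x)\<^sup>2 + 2 * (u x * v x))"
      using u v integrable_mult_square_integrable[OF u v] by (auto simp: square_integrable_def)
    then show "(\<lambda>x. u x + v x) \<in> square_integrable M"
      using u v by (auto simp: square_integrable_def power2_sum mult.assoc)
    show "(\<integral>x. u x * v x \<partial>M) = (\<integral>x. v x * u x \<partial>M)"
      by (simp add: mult.commute)
    assume w: "w \<in> square_integrable M"
    show "(\<integral>x. (u x + v x) * w x \<partial>M) = (\<integral>x. u x * w x \<partial>M) + (\<integral>x. v x * w x \<partial>M)"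
      using integrable_mult_square_integrable[OF u w] integrable_mult_square_integrable[OF v w]
      by (simp add: distrib_right) }
  show "(\<integral>x. c * u x * w x \<partial>M) = c * (\<integral>x. u x * w x \<partial>M)"
    by (simp add: mult.assoc)
qed

text \<open>Fatou's lemma for the squares. The bound is asked for eventually, since it is applied to
  \<open>U m - U n\<close> with \<open>n\<close> fixed and \<open>m\<close> tending to infinity,
  where it is known for \<open>n \<le> m\<close>.\<close>

lemma square_integrable_Fatou:
  assumes f: "\<And>n::nat. f n \<in> square_integrable M"
    and g: "g \<in> borel_measurable M"
    and lim: "AE x in M. (\<lambda>n. f n x) \<longlonglongrightarrow> g x"
    and bound: "\<forall>\<^sub>F n in sequentially. (\<integral>x. (f n x)\<^sup>2 \<partial>M) \<le> c"
  shows "g \<in> square_integrable M \<and> (\<integral>x. (g x)\<^sup>2 \<partial>M) \<le> c"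
proof -
  have f': "f n \<in> borel_measurable M" "integrable M (\<lambda>x. (f n x)\<^sup>2)" for n
    using f by (auto simp: square_integrable_def)
  \<comment> \<open>\<open>ennreal\<close> sends negative reals to 0, so the sign of
    \<open>c\<close> is needed to read the final bound back in the reals.\<close>
  have c: "0 \<le> c"
  proof -
    from bound obtain n where "(\<integral>x. (f n x)\<^sup>2 \<partial>M) \<le> c"
      using eventually_happens'[OF sequentially_bot] by blast
    moreover have "0 \<le> (\<integral>x. (f n x)\<^sup>2 \<partial>M)" by simp
    ultimately show ?thesis by linarith
  qed
  have "(\<integral>\<^sup>+x. ennreal ((g x)\<^sup>2) \<partial>M) = (\<integral>\<^sup>+x. liminf (\<lambda>n. ennreal ((f n x)\<^sup>2)) \<partial>M)"
  proof (rule nn_integral_cong_AE)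
    show "AE x in M. ennreal ((g x)\<^sup>2) = liminf (\<lambda>n. ennreal ((f n x)\<^sup>2))"
      using lim
    proof eventually_elim
      case (elim x)
      have "(\<lambda>n. ennreal ((f n x)\<^sup>2)) \<longlonglongrightarrow> ennreal ((g x)\<^sup>2)"
        by (intro tendsto_ennrealI tendsto_power elim)
      from lim_imp_Liminf[OF sequentially_bot this] show ?case by simp
    qed
  qed
  also have "\<dots> \<le> liminf (\<lambda>n. \<integral>\<^sup>+x. ennreal ((f n x)\<^sup>2) \<partial>M)"
    using f' by (intro nn_integral_liminf) auto
  also have "\<dots> \<le> ennreal c"
  proof (rule order_trans[OF Liminf_le_Limsup])
    show "limsup (\<lambda>n. \<integral>\<^sup>+x. ennreal ((f n x)\<^sup>2) \<partial>M) \<le> ennreal c"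
      using bound f' by (intro Limsup_bounded)
        (auto simp: nn_integral_eq_integral elim!: eventually_mono intro!: ennreal_leI)
  qed simp
  finally have *: "(\<integral>\<^sup>+x. ennreal ((g x)\<^sup>2) \<partial>M) \<le> ennreal c" .
  have "integrable M (\<lambda>x. (g x)\<^sup>2)"
    using g * by (intro integrableI_bounded) (auto simp: le_less_trans[OF _ ennreal_less_top])
  moreover from this have "(\<integral>x. (g x)\<^sup>2 \<partial>M) \<le> c"
    using * c by (simp add: nn_integral_eq_integral)
  ultimately show ?thesis using g by (simp add: square_integrable_def)
qed

text \<open>
  By the arithmetic-geometric mean inequality, the increment \<open>d\<^sub>n\<close> satisfies
  \<open>\<bar>d\<^sub>n\<bar> \<le> 2\<^sup>-\<^sup>n + 2\<^sup>n d\<^sub>n\<^sup>2\<close>, and the right-hand side has almost everywhere a finite sum.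
\<close>
lemma AE_convergent_square_integrable:
  fixes f :: "nat \<Rightarrow> 'a \<Rightarrow> real"
  assumes f: "\<And>n. f n \<in> borel_measurable M"
    and d: "\<And>n. integrable M (\<lambda>x. (f (Suc n) x - f n x)\<^sup>2)"
    and bound: "\<And>n. (\<integral>x. (f (Suc n) x - f n x)\<^sup>2 \<partial>M) \<le> C * (1/4) ^ n"
  shows "AE x in M. convergent (\<lambda>n. f n x)"
proof -
  let ?h = "\<lambda>n x. 2 ^ n * (f (Suc n) x - f n x)\<^sup>2"
  have [measurable]: "f n \<in> borel_measurable M" for n by (rule f)
  have C: "0 \<le> C"
  proof -
    have "0 \<le> (\<integral>x. (f (Suc 0) x - f 0 x)\<^sup>2 \<partial>M)" by simp
    also note bound[of 0]
    finally show ?thesis by simp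
  qed
  have "(\<integral>\<^sup>+x. (\<Sum>n. ennreal (?h n x)) \<partial>M) = (\<Sum>n. \<integral>\<^sup>+x. ennreal (?h n x) \<partial>M)"
    by (intro nn_integral_suminf) auto
  \<comment> \<open>The weight \<open>2 ^ n\<close> weakens the decay from \<open>(1/4) ^ n\<close>
    to \<open>(1/2) ^ n\<close>, which is still summable.\<close>
  also have "\<dots> \<le> (\<Sum>n. ennreal (C * (1/2) ^ n))"
  proof (intro suminf_le summableI)
    fix n
    have "(\<integral>\<^sup>+x. ennreal (?h n x) \<partial>M) = ennreal (\<integral>x. ?h n x \<partial>M)"
      using d by (intro nn_integral_eq_integral) auto
    also have "\<dots> \<le> ennreal (2 ^ n * (C * (1/4) ^ n))"
      using bound[of n] by (intro ennreal_leI) simp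
    also have "2 ^ n * (C * (1/4) ^ n) = C * (2 * (1/4)) ^ n"
      by (simp only: power_mult_distrib mult.left_commute)
    finally show "(\<integral>\<^sup>+x. ennreal (?h n x) \<partial>M) \<le> ennreal (C * (1/2) ^ n)" by simp
  qed
  also have "\<dots> = ennreal (\<Sum>n. C * (1/2) ^ n)"
    using C by (intro suminf_ennreal2 summable_mult summable_geometric) auto
  finally have "(\<integral>\<^sup>+x. (\<Sum>n. ennreal (?h n x)) \<partial>M) < \<infinity>"
    by (rule le_less_trans) simp
  then have "AE x in M. (\<Sum>n. ennreal (?h n x)) \<noteq> \<infinity>"
    by (intro nn_integral_noteq_infinite) auto
  then show ?thesis
  proof eventually_elim
    case (elim x)
    have "summable (\<lambda>n. ?h n x)"
      using elim by (intro summable_suminf_not_top) auto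
    then have "summable (\<lambda>n. (1/2) ^ n + ?h n x)"
      by (intro summable_add summable_geometric) auto
    then have "summable (\<lambda>n. f (Suc n) x - f n x)"
    proof (rule summable_comparison_test')
      fix n
      let ?d = "f (Suc n) x - f n x" and ?p = "2 ^ n :: real"
      have "0 \<le> (1 - ?p * \<bar>?d\<bar>)\<^sup>2 / ?p" by simp
      also have "\<dots> = 1 / ?p + ?p * ?d\<^sup>2 - 2 * \<bar>?d\<bar>"
        by (simp add: power2_diff power_mult_distrib add_divide_distrib diff_divide_distrib)
          (simp add: power2_eq_square)
      finally have "2 * \<bar>?d\<bar> \<le> 1 / ?p + ?h n x" by linarith
      moreover have "\<bar>?d\<bar> \<le> 2 * \<bar>?d\<bar>" by simp
      ultimately show "norm ?d \<le> (1/2) ^ n + ?h n x"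
        unfolding real_norm_def power_one_over by linarith
    qed
    then have "convergent (\<lambda>n. f n x - f 0 x)"
      by (simp add: summable_iff_convergent sum_lessThan_telescope[of "\<lambda>n. f n x"])
    from convergent_add[OF this convergent_const[of "f 0 x"]] show ?case by simp
  qed
qed

section \<open>Transport and combination of semi-inner products\<close>

text \<open>\<open>T\<close> is linear only as seen by the form, because the operator
  \<open>K\<close> satisfies its linearity identities merely almost everywhere. The equations for
  \<open>T\<close> are therefore tested against \<open>w\<close>.\<close>

lemma semi_inner_product_pullback:
  assumes "semi_inner_product V a"
    and zero: "(\<lambda>x. 0) \<in> W"
    and add: "\<And>u v. u \<in> W \<Longrightarrow> v \<in> W \<Longrightarrow> (\<lambda>x. u x + v x) \<in> W"
    and scale: "\<And>u c. u \<in> W \<Longrightarrow> (\<lambda>x. c * u x) \<in> W"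
    and T: "\<And>u. u \<in> W \<Longrightarrow> T u \<in> V"
    and T_add: "\<And>u v w. u \<in> W \<Longrightarrow> v \<in> W \<Longrightarrow> w \<in> V \<Longrightarrow>
      a (T (\<lambda>x. u x + v x)) w = a (\<lambda>x. T u x + T v x) w"
    and T_scale: "\<And>u c w. u \<in> W \<Longrightarrow> w \<in> V \<Longrightarrow> a (T (\<lambda>x. c * u x)) w = a (\<lambda>x. c * T u x) w"
  shows "semi_inner_product W (\<lambda>u v. a (T u) (T v))"
proof -
  interpret semi_inner_product V a by fact
  show ?thesis
    by unfold_locales
      (simp_all add: zero add scale T T_add T_scale add_left scale_left nonneg sym[OF T T])
qed

lemma semi_inner_product_add:
  assumes "semi_inner_product V a" "semi_inner_product V b" and c: "0 \<le> c"
  shows "semi_inner_product V (\<lambda>u v. a u v + c * b u v)"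
proof -
  interpret a: semi_inner_product V a by fact
  interpret b: semi_inner_product V b by fact
  show ?thesis
    by unfold_locales
      (use c in \<open>simp_all add: a.zero_mem a.add_mem a.scale_mem a.add_left b.add_left a.scale_left
        b.scale_left a.nonneg b.nonneg a.sym[of _ v for v] b.sym[of _ v for v] algebra_simps\<close>)
qed

section \<open>The space L^2 of the domain\<close>

text \<open>Extension by zero identifies \<open>L2 \<Omega>\<close> with functions square integrable
  on the whole space, from which its structure is pulled back.\<close>

lemma L2_iff: "f \<in> L2 \<Omega> \<longleftrightarrow> (\<lambda>x. indicator \<Omega> x * f x) \<in> square_integrable lborel"
proof -
  have "(\<lambda>x. (indicator \<Omega> x * f x)\<^sup>2) = (\<lambda>x. indicator \<Omega> x *\<^sub>R (f x)\<^sup>2)"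
    by (auto simp: indicator_def)
  then show ?thesis
    by (simp add: L2_def square_integrable_def set_borel_measurable_def set_integrable_def)
qed

lemma L2_inner_eq:
  "L2_inner \<Omega> f g = (\<integral>x. (indicator \<Omega> x * f x) * (indicator \<Omega> x * g x) \<partial>lborel)"
  unfolding L2_inner_def set_lebesgue_integral_def
  by (intro Bochner_Integration.integral_cong) (auto simp: indicator_def)

lemma L2_inner_cong_AE:
  assumes "f \<in> L2 \<Omega>" "f' \<in> L2 \<Omega>" "g \<in> L2 \<Omega>"
    and "AE x in lborel. x \<in> \<Omega> \<longrightarrow> f x = f' x"
  shows "L2_inner \<Omega> f g = L2_inner \<Omega> f' g"
  unfolding L2_inner_eq
proof (rule integral_cong_AE)
  show "AE x in lborel. (indicator \<Omega> x * f x) * (indicator \<Omega> x * g x) =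
      (indicator \<Omega> x * f' x) * (indicator \<Omega> x * g x)"
    using assms(4) by eventually_elim (auto simp: indicator_def)
qed (use assms(1-3) in \<open>auto simp: L2_iff square_integrable_def\<close>)

lemma semi_inner_product_L2:
  fixes \<Omega> :: "(real ^ 'n) set"
  shows "semi_inner_product (L2 \<Omega>) (L2_inner \<Omega>)"
proof -
  note S = semi_inner_product_square_integrable[of "lborel :: (real ^ 'n) measure"]
  have "semi_inner_product (L2 \<Omega>)
      (\<lambda>f g. \<integral>x. (indicator \<Omega> x * f x) * (indicator \<Omega> x * g x) \<partial>lborel)"
  proof (rule semi_inner_product_pullback[OF S, where T = "\<lambda>f x. indicator \<Omega> x * f x"])
    fix f g :: "real ^ 'n \<Rightarrow> real" and c
    assume f: "f \<in> L2 \<Omega>"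
    show "(\<lambda>x. c * f x) \<in> L2 \<Omega>"
      using semi_inner_product.scale_mem[OF S f[unfolded L2_iff], of c]
      by (simp add: L2_iff mult.left_commute)
    assume g: "g \<in> L2 \<Omega>"
    show "(\<lambda>x. f x + g x) \<in> L2 \<Omega>"
      using semi_inner_product.add_mem[OF S f[unfolded L2_iff] g[unfolded L2_iff]]
      by (simp add: L2_iff distrib_left)
  qed (simp_all add: L2_iff semi_inner_product.zero_mem[OF S] distrib_left mult.left_commute)
  then show ?thesis
    by (simp only: L2_inner_eq[abs_def])
qed

section \<open>Gagliardo difference quotients and the fractional Sobolev space\<close>

text \<open>The exponent is half of that in \<open>H0s_inner\<close>, so the Gagliardo form is the
  L^2 product of two quotients and membership in \<open>Hs\<close> is square integrability of
  \<open>u\<close> and of its quotient. On the diagonal the value is 0.\<close>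

definition gagliardo_quotient ::
  "real \<Rightarrow> (real ^ 'n \<Rightarrow> real) \<Rightarrow> (real ^ 'n) \<times> (real ^ 'n) \<Rightarrow> real" where
  "gagliardo_quotient s u =
     (\<lambda>(x, y). (u x - u y) / norm (x - y) powr ((real CARD('n) + 2 * s) / 2))"

lemma gagliardo_quotient_mult:
  fixes u v :: "real ^ 'n \<Rightarrow> real"
  shows "(\<lambda>p. gagliardo_quotient s u p * gagliardo_quotient s v p) =
    (\<lambda>(x, y). (u x - u y) * (v x - v y) / norm (x - y) powr (real CARD('n) + 2 * s))"
  by (auto simp: gagliardo_quotient_def fun_eq_iff simp flip: powr_add)

lemma gagliardo_quotient_add:
  "gagliardo_quotient s (\<lambda>x. u x + v x) =
    (\<lambda>p. gagliardo_quotient s u p + gagliardo_quotient s v p)"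
  by (auto simp: gagliardo_quotient_def fun_eq_iff simp flip: add_divide_distrib)

lemma gagliardo_quotient_scale:
  "gagliardo_quotient s (\<lambda>x. c * u x) = (\<lambda>p. c * gagliardo_quotient s u p)"
  by (auto simp: gagliardo_quotient_def fun_eq_iff right_diff_distrib)

lemma gagliardo_quotient_zero: "gagliardo_quotient s (\<lambda>x. 0) = (\<lambda>p. 0)"
  by (auto simp: gagliardo_quotient_def)

lemma measurable_gagliardo_quotient [measurable]:
  assumes [measurable]: "u \<in> borel_measurable lborel"
  shows "gagliardo_quotient s u \<in> borel_measurable (lborel \<Otimes>\<^sub>M lborel)"
  unfolding gagliardo_quotient_def by measurable

lemma Hs_iff:
  fixes u :: "real ^ 'n \<Rightarrow> real"
  shows "u \<in> Hs s \<longleftrightarrow> u \<in> square_integrable lborel \<and>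
    gagliardo_quotient s u \<in> square_integrable (lborel \<Otimes>\<^sub>M lborel)"
proof -
  have "(\<lambda>p. (gagliardo_quotient s u p)\<^sup>2) =
      (\<lambda>(x, y). (u x - u y)\<^sup>2 / norm (x - y) powr (real CARD('n) + 2 * s))"
    unfolding power2_eq_square by (rule gagliardo_quotient_mult)
  then show ?thesis
    by (auto simp: Hs_def square_integrable_def)
qed

lemma H0s_inner_eq:
  fixes \<Omega> :: "(real ^ 'n) set"
  shows "H0s_inner \<Omega> s u v = L2_inner \<Omega> u v + frac_lap_const CARD('n) s / 2 *
    (\<integral>p. gagliardo_quotient s u p * gagliardo_quotient s v p \<partial>(lborel \<Otimes>\<^sub>M lborel))"
  unfolding H0s_inner_def L2_inner_def gagliardo_quotient_mult ..

lemma frac_lap_const_pos: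
  assumes "0 < s" "s < 1"
  shows "0 < frac_lap_const N s"
  unfolding frac_lap_const_def using assms by (auto intro!: divide_pos_pos mult_pos_pos add_nonneg_pos)

lemma square_integrable_imp_L2:
  assumes "open \<Omega>" "u \<in> square_integrable lborel"
  shows "u \<in> L2 \<Omega>"
proof -
  have [measurable]: "\<Omega> \<in> sets borel" "u \<in> borel_measurable borel"
    using assms by (auto simp: square_integrable_def)
  have "integrable lborel (\<lambda>x. (indicator \<Omega> x * u x)\<^sup>2)"
    by (rule Bochner_Integration.integrable_bound[of _ "\<lambda>x. (u x)\<^sup>2"])
      (use assms in \<open>auto simp: square_integrable_def indicator_def\<close>)
  then show ?thesis
    by (simp add: L2_iff square_integrable_def)
qed

lemma H0s_closed:
  shows H0s_zero: "(\<lambda>x. 0) \<in> H0s \<Omega> s"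
    and H0s_add: "u \<in> H0s \<Omega> s \<Longrightarrow> v \<in> H0s \<Omega> s \<Longrightarrow> (\<lambda>x. u x + v x) \<in> H0s \<Omega> s"
    and H0s_scale: "u \<in> H0s \<Omega> s \<Longrightarrow> (\<lambda>x. c * u x) \<in> H0s \<Omega> s"
proof -
  note S = semi_inner_product_square_integrable
  note closed = semi_inner_product.zero_mem[OF S] semi_inner_product.add_mem[OF S]
    semi_inner_product.scale_mem[OF S]
  show "(\<lambda>x. 0) \<in> H0s \<Omega> s"
    by (simp add: H0s_def Hs_iff gagliardo_quotient_zero closed)
  assume u: "u \<in> H0s \<Omega> s"
  then have u0: "AE x in lborel. x \<notin> \<Omega> \<longrightarrow> u x = 0" by (simp add: H0s_def)
  have "AE x in lborel. x \<notin> \<Omega> \<longrightarrow> c * u x = 0"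
    using u0 by eventually_elim auto
  with u show "(\<lambda>x. c * u x) \<in> H0s \<Omega> s"
    by (simp add: H0s_def Hs_iff gagliardo_quotient_scale closed)
  assume v: "v \<in> H0s \<Omega> s"
  then have v0: "AE x in lborel. x \<notin> \<Omega> \<longrightarrow> v x = 0" by (simp add: H0s_def)
  have "AE x in lborel. x \<notin> \<Omega> \<longrightarrow> u x + v x = 0"
    using u0 v0 by eventually_elim auto
  with u v show "(\<lambda>x. u x + v x) \<in> H0s \<Omega> s"
    by (simp add: H0s_def Hs_iff gagliardo_quotient_add closed)
qed

lemma H0s_imp_L2: "open \<Omega> \<Longrightarrow> u \<in> H0s \<Omega> s \<Longrightarrow> u \<in> L2 \<Omega>"
  by (auto simp: H0s_def Hs_iff intro: square_integrable_imp_L2)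

lemma semi_inner_product_H0s:
  fixes \<Omega> :: "(real ^ 'n) set"
  assumes "open \<Omega>" "0 < s" "s < 1"
  shows "semi_inner_product (H0s \<Omega> s) (H0s_inner \<Omega> s)"
proof -
  have "semi_inner_product (H0s \<Omega> s) (L2_inner \<Omega>)"
    by (rule semi_inner_product_pullback[OF semi_inner_product_L2, where T = "\<lambda>u. u"])
      (auto simp: H0s_imp_L2[OF assms(1)] intro: H0s_closed)
  moreover have "semi_inner_product (H0s \<Omega> s) (\<lambda>u v.
      \<integral>p. gagliardo_quotient s u p * gagliardo_quotient s v p \<partial>(lborel \<Otimes>\<^sub>M lborel))"
    by (rule semi_inner_product_pullback[OF semi_inner_product_square_integrable])
      (simp_all add: gagliardo_quotient_add gagliardo_quotient_scale H0s_closed,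
        simp add: H0s_def Hs_iff)
  moreover have "0 \<le> frac_lap_const CARD('n) s / 2"
    using frac_lap_const_pos[OF assms(2,3), of "CARD('n)"] by simp
  ultimately show ?thesis
    unfolding H0s_inner_eq[abs_def] by (rule semi_inner_product_add)
qed

text \<open>Since \<open>u\<close> vanishes almost everywhere outside \<open>\<Omega>\<close>, the
  integral over \<open>\<Omega>\<close> is one over the whole space. The squared norm thus splits
  into two integrals of squares to which Fatou's lemma applies.\<close>

lemma H0s_inner_self:
  fixes \<Omega> :: "(real ^ 'n) set"
  assumes "open \<Omega>" "u \<in> H0s \<Omega> s"
  shows "H0s_inner \<Omega> s u u = (\<integral>x. (u x)\<^sup>2 \<partial>lborel) + frac_lap_const CARD('n) s / 2 *
    (\<integral>p. (gagliardo_quotient s u p)\<^sup>2 \<partial>(lborel \<Otimes>\<^sub>M lborel))"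
proof -
  have "(\<integral>x. (indicator \<Omega> x * u x) * (indicator \<Omega> x * u x) \<partial>lborel) = (\<integral>x. (u x)\<^sup>2 \<partial>lborel)"
  proof (rule integral_cong_AE)
    have "AE x in lborel. x \<notin> \<Omega> \<longrightarrow> u x = 0"
      using assms(2) by (simp add: H0s_def)
    then show "AE x in lborel. (indicator \<Omega> x * u x) * (indicator \<Omega> x * u x) = (u x)\<^sup>2"
      by eventually_elim (auto simp: indicator_def power2_eq_square)
  qed (use H0s_imp_L2[OF assms] assms(2) in \<open>auto simp: L2_iff H0s_def Hs_iff square_integrable_def\<close>)
  then show ?thesis
    by (simp add: H0s_inner_eq L2_inner_eq power2_eq_square)
qed

section \<open>Completeness and definiteness\<close>

text \<open>Transfers almost everywhere convergence of functions to their difference quotients. As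
  \<open>P\<close> is not assumed measurable, its exceptional set is enclosed in a measurable null
  set \<open>N\<close>; almost every pair avoids \<open>N\<close> in both coordinates by a Fubini
  argument.\<close>

lemma AE_pair_fst_snd:
  assumes "sigma_finite_measure M" "AE x in M. P x"
  shows "AE p in M \<Otimes>\<^sub>M M. P (fst p) \<and> P (snd p)"
proof -
  interpret sigma_finite_measure M by fact
  interpret pair_sigma_finite M M ..
  from assms(2) obtain N where N: "{x \<in> space M. \<not> P x} \<subseteq> N" "N \<in> null_sets M"
    by (auto elim!: AE_E intro: that)
  have [measurable]: "N \<in> sets M" using N(2) by auto
  have N': "AE x in M. x \<notin> N" using N(2) by (rule AE_not_in)
  have "AE p in M \<Otimes>\<^sub>M M. fst p \<notin> N \<and> snd p \<notin> N"
  proof (rule AE_pair_measure)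
    show "AE x in M. AE y in M. fst (x, y) \<notin> N \<and> snd (x, y) \<notin> N"
      using N' by eventually_elim (use N' in auto)
  qed measurable
  moreover have "AE p in M \<Otimes>\<^sub>M M. p \<in> space (M \<Otimes>\<^sub>M M)"
    by (rule AE_space)
  ultimately show ?thesis
    by eventually_elim (use N(1) in \<open>auto simp: space_pair_measure\<close>)
qed

lemma H0s_complete:
  fixes \<Omega> :: "(real ^ 'n) set"
  assumes \<Omega>: "open \<Omega>" and s: "0 < s" "s < 1"
    and U: "\<And>n::nat. U n \<in> H0s \<Omega> s"
    and Cauchy: "\<And>m n. n \<le> m \<Longrightarrow>
      H0s_inner \<Omega> s (\<lambda>x. U m x - U n x) (\<lambda>x. U m x - U n x) \<le> C * (1/4) ^ n"
  shows "\<exists>u \<in> H0s \<Omega> s. (\<lambda>n. H0s_inner \<Omega> s (\<lambda>x. u x - U n x) (\<lambda>x. u x - U n x)) \<longlonglongrightarrow> 0"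
proof -
  interpret H: semi_inner_product "H0s \<Omega> s" "H0s_inner \<Omega> s"
    by (rule semi_inner_product_H0s[OF \<Omega> s])
  define c where "c = frac_lap_const CARD('n) s / 2"
  have c: "c > 0"
    unfolding c_def using frac_lap_const_pos[OF s] by simp
  have d_mem: "(\<lambda>x. U m x - U n x) \<in> H0s \<Omega> s" for m n
    by (intro H.diff_mem U)
  have d_L2: "(\<lambda>x. U m x - U n x) \<in> square_integrable lborel"
    and d_quot: "gagliardo_quotient s (\<lambda>x. U m x - U n x) \<in> square_integrable (lborel \<Otimes>\<^sub>M lborel)" for m n
    using d_mem[of m n] by (auto simp: H0s_def Hs_iff)
  \<comment> \<open>Both summands of the squared norm are nonnegative, so each inherits the bound;
    the weight \<open>c\<close> is positive and can be divided out.\<close>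
  have d_bound: "(\<integral>x. (U m x - U n x)\<^sup>2 \<partial>lborel) \<le> C * (1/4) ^ n"
    "(\<integral>p. (gagliardo_quotient s (\<lambda>x. U m x - U n x) p)\<^sup>2 \<partial>(lborel \<Otimes>\<^sub>M lborel)) \<le> C * (1/4) ^ n / c"
    if "n \<le> m" for m n
  proof -
    let ?A = "\<integral>x. (U m x - U n x)\<^sup>2 \<partial>lborel"
    let ?B = "\<integral>p. (gagliardo_quotient s (\<lambda>x. U m x - U n x) p)\<^sup>2 \<partial>(lborel \<Otimes>\<^sub>M lborel)"
    have "?A + c * ?B \<le> C * (1/4) ^ n"
      using Cauchy[OF that] unfolding H0s_inner_self[OF \<Omega> d_mem] c_def .
    moreover have "0 \<le> ?A" "0 \<le> c * ?B" using c by simp_all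
    ultimately have "?A \<le> C * (1/4) ^ n" "c * ?B \<le> C * (1/4) ^ n" by linarith+
    then show "?A \<le> C * (1/4) ^ n" "?B \<le> C * (1/4) ^ n / c"
      using c by (simp_all add: field_simps)
  qed
  have U_meas: "U n \<in> borel_measurable lborel" for n
    using U[of n] by (auto simp: H0s_def Hs_def)
  \<comment> \<open>Where the sequence diverges, \<open>lim\<close> returns an unspecified value;
    this happens only on a null set, and \<open>u\<close> is measurable on the whole space.\<close>
  define u where "u x = lim (\<lambda>n. U n x)" for x
  have u_meas: "u \<in> borel_measurable lborel"
    unfolding u_def using U_meas by (rule borel_measurable_lim_metric)
  have "AE x in lborel. convergent (\<lambda>n. U n x)"
  proof (rule AE_convergent_square_integrable[OF U_meas])
    show "integrable lborel (\<lambda>x. (U (Suc n) x - U n x)\<^sup>2)" for n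
      using d_L2[of "Suc n" n] by (simp add: square_integrable_def)
    show "(\<integral>x. (U (Suc n) x - U n x)\<^sup>2 \<partial>lborel) \<le> C * (1/4) ^ n" for n
      by (rule d_bound) simp
  qed
  then have lim: "AE x in lborel. (\<lambda>n. U n x) \<longlonglongrightarrow> u x"
    by eventually_elim (simp add: u_def convergent_LIMSEQ_iff)
  \<comment> \<open>With \<open>n\<close> fixed, \<open>m\<close> tends to infinity in the Cauchy
    bound.\<close>
  have e_L2: "(\<lambda>x. u x - U n x) \<in> square_integrable lborel \<and>
      (\<integral>x. (u x - U n x)\<^sup>2 \<partial>lborel) \<le> C * (1/4) ^ n" for n
  proof (rule square_integrable_Fatou[OF d_L2])
    show "AE x in lborel. (\<lambda>m. U m x - U n x) \<longlonglongrightarrow> u x - U n x"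
      using lim by eventually_elim (intro tendsto_intros)
    show "\<forall>\<^sub>F m in sequentially. (\<integral>x. (U m x - U n x)\<^sup>2 \<partial>lborel) \<le> C * (1/4) ^ n"
      using d_bound(1) by (auto simp: eventually_sequentially)
  qed (rule borel_measurable_diff[OF u_meas U_meas])
  have e_quot: "gagliardo_quotient s (\<lambda>x. u x - U n x) \<in> square_integrable (lborel \<Otimes>\<^sub>M lborel) \<and>
      (\<integral>p. (gagliardo_quotient s (\<lambda>x. u x - U n x) p)\<^sup>2 \<partial>(lborel \<Otimes>\<^sub>M lborel)) \<le> C * (1/4) ^ n / c" for n
  proof (rule square_integrable_Fatou[OF d_quot])
    show "gagliardo_quotient s (\<lambda>x. u x - U n x) \<in> borel_measurable (lborel \<Otimes>\<^sub>M lborel)"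
      by (intro measurable_gagliardo_quotient borel_measurable_diff u_meas U_meas)
    show "AE p in lborel \<Otimes>\<^sub>M lborel. (\<lambda>m. gagliardo_quotient s (\<lambda>x. U m x - U n x) p)
        \<longlonglongrightarrow> gagliardo_quotient s (\<lambda>x. u x - U n x) p"
      using AE_pair_fst_snd[OF sigma_finite_lborel lim]
    proof eventually_elim
      case (elim p)
      \<comment> \<open>The denominator does not depend on \<open>m\<close>; writing it as a factor
        \<open>inverse\<close> covers the diagonal, where it is 0.\<close>
      then show ?case
        unfolding gagliardo_quotient_def divide_inverse
        by (auto simp: case_prod_beta intro!: tendsto_intros)
    qed
    show "\<forall>\<^sub>F m in sequentially.
        (\<integral>p. (gagliardo_quotient s (\<lambda>x. U m x - U n x) p)\<^sup>2 \<partial>(lborel \<Otimes>\<^sub>M lborel)) \<le> C * (1/4) ^ n / c"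
      using d_bound(2) by (auto simp: eventually_sequentially)
  qed
  have zero: "AE x in lborel. x \<notin> \<Omega> \<longrightarrow> u x - U n x = 0" for n
  proof -
    have "AE x in lborel. \<forall>n. x \<notin> \<Omega> \<longrightarrow> U n x = 0"
      unfolding AE_all_countable using U by (auto simp: H0s_def)
    with lim show ?thesis
      by eventually_elim (auto simp: LIMSEQ_const_iff)
  qed
  have e_mem: "(\<lambda>x. u x - U n x) \<in> H0s \<Omega> s" for n
    using e_L2[of n] e_quot[of n] zero[of n] by (simp add: H0s_def Hs_iff)
  show ?thesis
  proof
    show "u \<in> H0s \<Omega> s"
      using H.add_mem[OF e_mem[of 0] U[of 0]] by simp
    show "(\<lambda>n. H0s_inner \<Omega> s (\<lambda>x. u x - U n x) (\<lambda>x. u x - U n x)) \<longlonglongrightarrow> 0"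
    proof (rule tendsto_sandwich[OF _ _ tendsto_const])
      show "\<forall>\<^sub>F n in sequentially. 0 \<le> H0s_inner \<Omega> s (\<lambda>x. u x - U n x) (\<lambda>x. u x - U n x)"
        using H.nonneg[OF e_mem] by simp
      have "H0s_inner \<Omega> s (\<lambda>x. u x - U n x) (\<lambda>x. u x - U n x) \<le> 2 * C * (1/4) ^ n" for n
      proof -
        have "c * (\<integral>p. (gagliardo_quotient s (\<lambda>x. u x - U n x) p)\<^sup>2 \<partial>(lborel \<Otimes>\<^sub>M lborel)) \<le> C * (1/4) ^ n"
          using e_quot[of n] c by (simp add: pos_le_divide_eq mult.commute)
        then show ?thesis
          using e_L2[of n] unfolding H0s_inner_self[OF \<Omega> e_mem] c_def[symmetric] by linarith
      qed
      then show "\<forall>\<^sub>F n in sequentially.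
          H0s_inner \<Omega> s (\<lambda>x. u x - U n x) (\<lambda>x. u x - U n x) \<le> 2 * C * (1/4) ^ n"
        by simp
      show "(\<lambda>n. 2 * C * (1/4) ^ n) \<longlonglongrightarrow> 0"
        by (intro tendsto_mult_right_zero LIMSEQ_power_zero) simp
    qed
  qed
qed

text \<open>The Gagliardo part is nonnegative, so already the L^2 part must vanish. This is the
  definiteness up to null sets behind uniqueness.\<close>

lemma H0s_inner_self_eq_0_imp_AE:
  fixes \<Omega> :: "(real ^ 'n) set"
  assumes "open \<Omega>" "0 < s" "s < 1" "u \<in> H0s \<Omega> s" "H0s_inner \<Omega> s u u \<le> 0"
  shows "AE x in lborel. u x = 0"
proof -
  have "0 \<le> frac_lap_const CARD('n) s / 2 *
      (\<integral>p. (gagliardo_quotient s u p)\<^sup>2 \<partial>(lborel \<Otimes>\<^sub>M lborel))"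
    using frac_lap_const_pos[OF assms(2,3), of "CARD('n)"] by (intro mult_nonneg_nonneg) auto
  moreover have "0 \<le> (\<integral>x. (u x)\<^sup>2 \<partial>lborel)" by simp
  ultimately have "(\<integral>x. (u x)\<^sup>2 \<partial>lborel) = 0"
    using assms(5) H0s_inner_self[OF assms(1,4)] by linarith
  moreover have "integrable lborel (\<lambda>x. (u x)\<^sup>2)"
    using assms(4) by (simp add: H0s_def Hs_def)
  ultimately show ?thesis
    by (simp add: integral_nonneg_eq_0_iff_AE)
qed

text \<open>Paired with \<open>g\<close>, the almost everywhere identities for \<open>K\<close>
  become exact ones, in the shape required by \<open>semi_inner_product_pullback\<close>.\<close>

lemma bounded_linear_H0s_L2D:
  assumes "bounded_linear_H0s_L2 \<Omega> s K"
  shows bounded_linear_H0s_L2_mem: "u \<in> H0s \<Omega> s \<Longrightarrow> K u \<in> L2 \<Omega>"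
    and bounded_linear_H0s_L2_add: "u \<in> H0s \<Omega> s \<Longrightarrow> v \<in> H0s \<Omega> s \<Longrightarrow> g \<in> L2 \<Omega> \<Longrightarrow>
      L2_inner \<Omega> (K (\<lambda>x. u x + v x)) g = L2_inner \<Omega> (\<lambda>x. K u x + K v x) g"
    and bounded_linear_H0s_L2_scale: "u \<in> H0s \<Omega> s \<Longrightarrow> g \<in> L2 \<Omega> \<Longrightarrow>
      L2_inner \<Omega> (K (\<lambda>x. c * u x)) g = L2_inner \<Omega> (\<lambda>x. c * K u x) g"
proof -
  note L2 = semi_inner_product_L2[of \<Omega>]
  have K: "K u \<in> L2 \<Omega>" if "u \<in> H0s \<Omega> s" for u
    using assms that by (simp add: bounded_linear_H0s_L2_def)
  assume u: "u \<in> H0s \<Omega> s"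
  show "K u \<in> L2 \<Omega>" by (rule K[OF u])
  { assume g: "g \<in> L2 \<Omega>"
    show "L2_inner \<Omega> (K (\<lambda>x. c * u x)) g = L2_inner \<Omega> (\<lambda>x. c * K u x) g"
    proof (rule L2_inner_cong_AE)
      show "AE x in lborel. x \<in> \<Omega> \<longrightarrow> K (\<lambda>x. c * u x) x = c * K u x"
        using assms u by (simp add: bounded_linear_H0s_L2_def)
    qed (intro K H0s_scale semi_inner_product.scale_mem[OF L2] u g)+ }
  assume v: "v \<in> H0s \<Omega> s" and g: "g \<in> L2 \<Omega>"
  show "L2_inner \<Omega> (K (\<lambda>x. u x + v x)) g = L2_inner \<Omega> (\<lambda>x. K u x + K v x) g"
  proof (rule L2_inner_cong_AE)
    show "AE x in lborel. x \<in> \<Omega> \<longrightarrow> K (\<lambda>x. u x + v x) x = K u x + K v x"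
      using assms u v by (simp add: bounded_linear_H0s_L2_def)
  qed (intro K H0s_add semi_inner_product.add_mem[OF L2] u v g)+
qed

theorem theorem2p3:
  fixes \<Omega> :: "(real ^ 'n) set"
    and s \<alpha> :: real
    and K :: "(real ^ 'n \<Rightarrow> real) \<Rightarrow> (real ^ 'n \<Rightarrow> real)"
    and y :: "real ^ 'n \<Rightarrow> real"
  assumes "bounded_lipschitz_domain \<Omega>"
    and "0 < s" and "s < 1"
    and "\<alpha> > 0"
    and "y \<in> L2 \<Omega>"
    and "bounded_linear_H0s_L2 \<Omega> s K"
  shows "(\<exists>u. unique_in_H0s \<Omega> s (minimizes_Tikhonov \<Omega> s K y \<alpha>) u) \<and>
    (\<forall>u. unique_in_H0s \<Omega> s (minimizes_Tikhonov \<Omega> s K y \<alpha>) u \<longrightarrow>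
       (\<forall>v \<in> H0s \<Omega> s. L2_inner \<Omega> (\<lambda>x. K u x - y x) (K v) + \<alpha> * H0s_inner \<Omega> s u v = 0)) \<and>
    (\<forall>u. (unique_in_H0s \<Omega> s (minimizes_Tikhonov \<Omega> s K y \<alpha>) u \<longleftrightarrow>
            unique_in_H0s \<Omega> s (weak_solution \<Omega> s K y \<alpha>) u) \<and>
         (unique_in_H0s \<Omega> s (weak_solution \<Omega> s K y \<alpha>) u \<longleftrightarrow>
            unique_in_H0s \<Omega> s (residual_equation \<Omega> s K y \<alpha>) u) \<and>
         (unique_in_H0s \<Omega> s (residual_equation \<Omega> s K y \<alpha>) u \<longleftrightarrow>
            unique_in_H0s \<Omega> s (normal_equation \<Omega> s K y \<alpha>) u)) \<and>
    (\<forall>u \<in> H0s \<Omega> s.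
       (weak_solution \<Omega> s K y \<alpha> u \<longleftrightarrow> residual_equation \<Omega> s K y \<alpha> u) \<and>
       (residual_equation \<Omega> s K y \<alpha> u \<longleftrightarrow> normal_equation \<Omega> s K y \<alpha> u))"
proof -

  \<comment> \<open>The energy form and the Tikhonov functional\<close>
  have \<Omega>: "open \<Omega>" using assms(1) by (simp add: bounded_lipschitz_domain_def)
  note s = assms(2,3) and \<alpha> = assms(4) and y = assms(5) and K = assms(6)
  note K_mem = bounded_linear_H0s_L2_mem[OF K]
  interpret L: semi_inner_product "L2 \<Omega>" "L2_inner \<Omega>"
    by (rule semi_inner_product_L2)
  interpret H: semi_inner_product "H0s \<Omega> s" "H0s_inner \<Omega> s"
    by (rule semi_inner_product_H0s[OF \<Omega> s])
  define a where "a u v = L2_inner \<Omega> (K u) (K v) + \<alpha> * H0s_inner \<Omega> s u v" for u v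
  define l where "l v = L2_inner \<Omega> y (K v)" for v
  have KK: "semi_inner_product (H0s \<Omega> s) (\<lambda>u v. L2_inner \<Omega> (K u) (K v))"
    by (rule semi_inner_product_pullback[OF L.semi_inner_product_axioms])
      (simp_all add: H0s_closed K_mem bounded_linear_H0s_L2_add[OF K]
        bounded_linear_H0s_L2_scale[OF K])
  interpret A: semi_inner_product "H0s \<Omega> s" a
    unfolding a_def[abs_def]
    by (rule semi_inner_product_add[OF KK H.semi_inner_product_axioms]) (use \<alpha> in simp)
  obtain B0 where B0: "\<And>u. u \<in> H0s \<Omega> s \<Longrightarrow> L2_norm \<Omega> (K u) \<le> B0 * H0s_norm \<Omega> s u"
    using K unfolding bounded_linear_H0s_L2_def by blast

  have pair_add: "L2_inner \<Omega> g (K (\<lambda>x. u x + v x)) = L2_inner \<Omega> g (K u) + L2_inner \<Omega> g (K v)"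
    if "g \<in> L2 \<Omega>" "u \<in> H0s \<Omega> s" "v \<in> H0s \<Omega> s" for g u v
    using that bounded_linear_H0s_L2_add[OF K that(2,3,1)]
    by (simp add: L.sym[of g] L.add_left K_mem H0s_add)
  have pair_scale: "L2_inner \<Omega> g (K (\<lambda>x. c * u x)) = c * L2_inner \<Omega> g (K u)"
    if "g \<in> L2 \<Omega>" "u \<in> H0s \<Omega> s" for g u c
    using that bounded_linear_H0s_L2_scale[OF K that(2,1)]
    by (simp add: L.sym[of g] L.scale_left K_mem H0s_scale)
  have l_linear: "\<forall>u \<in> H0s \<Omega> s. \<forall>v \<in> H0s \<Omega> s. \<forall>t. l (\<lambda>x. u x + t * v x) = l u + t * l v"
    unfolding l_def by (simp add: pair_add pair_scale y H0s_scale)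

  have residual: "L2_inner \<Omega> (\<lambda>x. K u x - y x) (K v) = L2_inner \<Omega> (K u) (K v) - l v"
    if "u \<in> H0s \<Omega> s" "v \<in> H0s \<Omega> s" for u v
    unfolding l_def using that by (intro L.diff_left K_mem y)
  \<comment> \<open>Expanding the residual leaves the term \<open>L2_inner \<Omega> y y / 2\<close>,
    which is independent of \<open>u\<close> and so does not affect minimizers.\<close>
  have Tikhonov: "Tikhonov \<Omega> s K y \<alpha> u = (a u u / 2 - l u) + L2_inner \<Omega> y y / 2"
    if u: "u \<in> H0s \<Omega> s" for u
  proof -
    have r: "(\<lambda>x. K u x - y x) \<in> L2 \<Omega>" by (intro L.diff_mem K_mem y u)
    have "L2_inner \<Omega> (\<lambda>x. K u x - y x) (\<lambda>x. K u x - y x) =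
        L2_inner \<Omega> (K u) (K u) - 2 * l u + L2_inner \<Omega> y y"
      using L.diff_right[OF K_mem[OF u] y r] residual[OF u u] L.diff_left[OF K_mem[OF u] y y]
        L.sym[OF K_mem[OF u] y]
      by (simp add: l_def)
    then show ?thesis
      using L.nonneg[OF r] H.nonneg[OF u]
      by (simp add: Tikhonov_def L2_norm_def H0s_norm_def a_def field_simps)
  qed

  \<comment> \<open>Equivalence of minimization, weak form and the two dual equations\<close>
  have weak_iff: "weak_solution \<Omega> s K y \<alpha> u \<longleftrightarrow> (\<forall>v \<in> H0s \<Omega> s. a u v = l v)"
    if "u \<in> H0s \<Omega> s" for u
    unfolding weak_solution_def a_def using residual[OF that] by (intro ball_cong) auto
  have min_iff: "minimizes_Tikhonov \<Omega> s K y \<alpha> u \<longleftrightarrow> weak_solution \<Omega> s K y \<alpha> u"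
    if u: "u \<in> H0s \<Omega> s" for u
    using A.minimizer_iff_Euler_Lagrange[OF u l_linear]
    by (simp add: weak_iff[OF u] minimizes_Tikhonov_def Tikhonov u)

  \<comment> \<open>The free coefficient \<open>\<beta>\<close> covers the functionals built from
    \<open>K\<close>: \<open>\<alpha>\<close> for the left-hand sides of both equations, 0 for
    \<open>adjoint_K \<Omega> K y\<close>. The bound combines Cauchy-Schwarz in both spaces with
    boundedness of \<open>K\<close>.\<close>
  have dual: "(\<lambda>v. L2_inner \<Omega> g (K v) + \<beta> * H0s_inner \<Omega> s u v) \<in> dual_H0s \<Omega> s"
    if g: "g \<in> L2 \<Omega>" and u: "u \<in> H0s \<Omega> s" for g u \<beta>
  proof -
    have "\<bar>L2_inner \<Omega> g (K v) + \<beta> * H0s_inner \<Omega> s u v\<bar>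
        \<le> (L2_norm \<Omega> g * B0 + \<bar>\<beta>\<bar> * H0s_norm \<Omega> s u) * H0s_norm \<Omega> s v"
      if v: "v \<in> H0s \<Omega> s" for v
    proof -
      have "\<bar>L2_inner \<Omega> g (K v)\<bar> \<le> L2_norm \<Omega> g * L2_norm \<Omega> (K v)"
        unfolding L2_norm_def by (intro L.abs_le_sqrt g K_mem v)
      also have "\<dots> \<le> L2_norm \<Omega> g * (B0 * H0s_norm \<Omega> s v)"
        using L.nonneg[OF g] by (intro mult_left_mono B0 v) (simp add: L2_norm_def)
      finally have 1: "\<bar>L2_inner \<Omega> g (K v)\<bar> \<le> L2_norm \<Omega> g * (B0 * H0s_norm \<Omega> s v)" .
      have "\<bar>H0s_inner \<Omega> s u v\<bar> \<le> H0s_norm \<Omega> s u * H0s_norm \<Omega> s v"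
        unfolding H0s_norm_def by (intro H.abs_le_sqrt u v)
      then have "\<bar>\<beta> * H0s_inner \<Omega> s u v\<bar> \<le> \<bar>\<beta>\<bar> * (H0s_norm \<Omega> s u * H0s_norm \<Omega> s v)"
        unfolding abs_mult by (intro mult_left_mono) auto
      with 1 have "\<bar>L2_inner \<Omega> g (K v)\<bar> + \<bar>\<beta> * H0s_inner \<Omega> s u v\<bar>
          \<le> (L2_norm \<Omega> g * B0 + \<bar>\<beta>\<bar> * H0s_norm \<Omega> s u) * H0s_norm \<Omega> s v"
        by (simp add: distrib_right mult.assoc)
      then show ?thesis
        by (rule order_trans[OF abs_triangle_ineq])
    qed
    then have "\<exists>B. \<forall>v \<in> H0s \<Omega> s.
        \<bar>L2_inner \<Omega> g (K v) + \<beta> * H0s_inner \<Omega> s u v\<bar> \<le> B * H0s_norm \<Omega> s v"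
      by blast
    then show ?thesis
      unfolding dual_H0s_def
      by (simp add: pair_add pair_scale H.add_right H.scale_right g u distrib_left mult.left_commute)
  qed
  have zero_dual: "(\<lambda>v. 0) \<in> dual_H0s \<Omega> s"
    by (auto simp: dual_H0s_def intro!: exI[of _ 0])
  \<comment> \<open>Once both sides are known to lie in the dual space, equality of functionals is
    the weak formulation itself.\<close>
  have residual_iff: "residual_equation \<Omega> s K y \<alpha> u \<longleftrightarrow> weak_solution \<Omega> s K y \<alpha> u"
    if u: "u \<in> H0s \<Omega> s" for u
    using dual[OF L.diff_mem[OF K_mem[OF u] y] u, of \<alpha>] zero_dual
    by (simp add: residual_equation_def eq_in_dual_H0s_def adjoint_K_def I_plus_frac_lap_def
        weak_solution_def)
  have normal_iff: "normal_equation \<Omega> s K y \<alpha> u \<longleftrightarrow> weak_solution \<Omega> s K y \<alpha> u"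
    if u: "u \<in> H0s \<Omega> s" for u
    using dual[OF K_mem[OF u] u, of \<alpha>] dual[OF y u, of 0]
    by (simp add: normal_equation_def eq_in_dual_H0s_def adjoint_K_def I_plus_frac_lap_def
        weak_iff[OF u] a_def l_def)

  have "\<exists>u \<in> H0s \<Omega> s. \<forall>v \<in> H0s \<Omega> s. a u v = l v"
  proof (rule A.Euler_Lagrange_solvable[OF l_linear])
    fix u assume u: "u \<in> H0s \<Omega> s"
    have "\<bar>l u\<bar> \<le> L2_norm \<Omega> y * sqrt (L2_inner \<Omega> (K u) (K u))"
      unfolding l_def L2_norm_def by (intro L.abs_le_sqrt y K_mem u)
    also have "\<dots> \<le> L2_norm \<Omega> y * sqrt (a u u)"
      using L.nonneg[OF y] H.nonneg[OF u] \<alpha>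
      by (intro mult_left_mono real_sqrt_le_mono) (simp_all add: a_def L2_norm_def)
    finally show "\<bar>l u\<bar> \<le> L2_norm \<Omega> y * sqrt (a u u)" .
  next
    fix U :: "nat \<Rightarrow> real ^ 'n \<Rightarrow> real" and C
    assume U: "\<And>n. U n \<in> H0s \<Omega> s"
      and Cauchy: "\<And>m n. n \<le> m \<Longrightarrow> a (\<lambda>x. U m x - U n x) (\<lambda>x. U m x - U n x) \<le> C * (1/4) ^ n"
    have "H0s_inner \<Omega> s (\<lambda>x. U m x - U n x) (\<lambda>x. U m x - U n x) \<le> C / \<alpha> * (1/4) ^ n"
      if "n \<le> m" for m n
      using Cauchy[OF that] L.nonneg[OF K_mem[OF H.diff_mem[OF U[of m] U[of n]]]] \<alpha>
      by (simp add: a_def pos_le_divide_eq mult.commute)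
    from H0s_complete[OF \<Omega> s U this] obtain u where u: "u \<in> H0s \<Omega> s"
      and lim: "(\<lambda>n. H0s_inner \<Omega> s (\<lambda>x. u x - U n x) (\<lambda>x. u x - U n x)) \<longlonglongrightarrow> 0"
      by blast
    have "(\<lambda>n. a (\<lambda>x. u x - U n x) (\<lambda>x. u x - U n x)) \<longlonglongrightarrow> 0"
    proof (rule tendsto_sandwich[OF _ _ tendsto_const])
      show "\<forall>\<^sub>F n in sequentially. 0 \<le> a (\<lambda>x. u x - U n x) (\<lambda>x. u x - U n x)"
        using A.nonneg[OF H.diff_mem[OF u U]] by simp
      have "a e e \<le> (B0\<^sup>2 + \<alpha>) * H0s_inner \<Omega> s e e" if e: "e \<in> H0s \<Omega> s" for e
      proof -
        have "(L2_norm \<Omega> (K e))\<^sup>2 \<le> (B0 * H0s_norm \<Omega> s e)\<^sup>2"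
          using L.nonneg[OF K_mem[OF e]] by (intro power_mono B0 e) (simp add: L2_norm_def)
        then show ?thesis
          using L.nonneg[OF K_mem[OF e]] H.nonneg[OF e]
          by (simp add: a_def L2_norm_def H0s_norm_def power_mult_distrib distrib_right)
      qed
      then show "\<forall>\<^sub>F n in sequentially. a (\<lambda>x. u x - U n x) (\<lambda>x. u x - U n x)
          \<le> (B0\<^sup>2 + \<alpha>) * H0s_inner \<Omega> s (\<lambda>x. u x - U n x) (\<lambda>x. u x - U n x)"
        using H.diff_mem[OF u U] by simp
      show "(\<lambda>n. (B0\<^sup>2 + \<alpha>) * H0s_inner \<Omega> s (\<lambda>x. u x - U n x) (\<lambda>x. u x - U n x)) \<longlonglongrightarrow> 0"
        by (intro tendsto_mult_right_zero lim)
    qed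
    with u show "\<exists>u \<in> H0s \<Omega> s. (\<lambda>n. a (\<lambda>x. u x - U n x) (\<lambda>x. u x - U n x)) \<longlonglongrightarrow> 0"
      by blast
  qed
  then obtain u0 where u0: "u0 \<in> H0s \<Omega> s" "weak_solution \<Omega> s K y \<alpha> u0"
    using weak_iff by blast
  have unique: "AE x in lborel. w x = u x"
    if u: "u \<in> H0s \<Omega> s" "weak_solution \<Omega> s K y \<alpha> u"
      and w: "w \<in> H0s \<Omega> s" "weak_solution \<Omega> s K y \<alpha> w" for u w
  proof -
    let ?e = "\<lambda>x. w x - u x"
    have e: "?e \<in> H0s \<Omega> s" by (intro H.diff_mem u w)
    have "a ?e ?e = 0"
      using u w e A.diff_left[OF w(1) u(1) e] by (simp add: weak_iff)
    then have "\<alpha> * H0s_inner \<Omega> s ?e ?e \<le> 0"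
      using L.nonneg[OF K_mem[OF e]] unfolding a_def by linarith
    then have "H0s_inner \<Omega> s ?e ?e \<le> 0"
      using \<alpha> by (simp add: mult_le_0_iff)
    then have "AE x in lborel. ?e x = 0"
      by (rule H0s_inner_self_eq_0_imp_AE[OF \<Omega> s e])
    then show ?thesis by eventually_elim simp
  qed

  have unique_iff: "unique_in_H0s \<Omega> s P u \<longleftrightarrow> u \<in> H0s \<Omega> s \<and> weak_solution \<Omega> s K y \<alpha> u"
    if "\<forall>u \<in> H0s \<Omega> s. P u \<longleftrightarrow> weak_solution \<Omega> s K y \<alpha> u" for P u
    unfolding unique_in_H0s_def using that unique by blast
  have unique_iffs: "unique_in_H0s \<Omega> s P u \<longleftrightarrow> u \<in> H0s \<Omega> s \<and> weak_solution \<Omega> s K y \<alpha> u"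
    if "P \<in> {minimizes_Tikhonov \<Omega> s K y \<alpha>, weak_solution \<Omega> s K y \<alpha>,
      residual_equation \<Omega> s K y \<alpha>, normal_equation \<Omega> s K y \<alpha>}" for P u
    using that min_iff residual_iff normal_iff by (intro unique_iff) auto
  show ?thesis
    using u0 residual_iff normal_iff by (auto simp: unique_iffs) (auto simp: weak_solution_def)
qed

end
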